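(* Let $G$ be a connected graph of order at least $3$. Then $G$ admits a $\Delta$-convex $2$-partition if and only if the graph $T(G)$ is disconnected.
   Context: Graphs are finite, simple and undirected. A triangle of $G$ is a set of three pairwise adjacent vertices. A set $S \subseteq V(G)$ is $\Delta$-convex if there is no vertex $w \in V(G)\setminus S$ that forms a triangle with two vertices of $S$. A $\Delta$-convex $2$-partition of $G$ is a family of two disjoint non-empty $\Delta$-convex sets of $G$ whose union is $V(G)$. The graph $T(G)$ is constructed from $G$ as follows: its vertex set has one vertex for every triangle of $G$ and one vertex for every vertex of $G$ that does not belong to any triangle of $G$; two distinct vertices of $T(G)$ are adjacent if and only if both are associated with triangles of $G$ and these two triangles share at least one vertex of $G$. *)

theory Defs
  imports
    "Graph_Theory.Pair_Digraph"
    "Graph_Theory.Digraph_Component"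
    "HOL-Library.Disjoint_Sets"
begin

text \<open>
  A finite simple undirected graph is a \<open>pair_graph\<close>: a symmetric loop-free relation
  \<open>parcs G\<close> on the finite vertex set \<open>pverts G\<close>.  Connectedness is the library's
  \<^const>\<open>Digraph_Component.connected\<close>, for which the null graph is not connected.
\<close>

definition triangles :: "'a pair_pre_digraph \<Rightarrow> 'a set set" where
  "triangles G = {t. t \<subseteq> pverts G \<and> card t = 3 \<and> pairwise (\<lambda>u v. (u, v) \<in> parcs G) t}"

text \<open>
  Members of \<^const>\<open>triangles\<close> have exactly three elements, so \<open>u\<close>, \<open>v\<close>, \<open>w\<close> below are
  automatically distinct.
\<close>

definition delta_convex :: "'a pair_pre_digraph \<Rightarrow> 'a set \<Rightarrow> bool" where
  "delta_convex G S \<longleftrightarrow>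
     S \<subseteq> pverts G \<and> \<not> (\<exists>w \<in> pverts G - S. \<exists>u \<in> S. \<exists>v \<in> S. {u, v, w} \<in> triangles G)"

text \<open>Non-emptiness of the parts is included in \<^const>\<open>partition_on\<close>.\<close>

definition delta_convex_2_partition :: "'a pair_pre_digraph \<Rightarrow> 'a set set \<Rightarrow> bool" where
  "delta_convex_2_partition G P \<longleftrightarrow>
     partition_on (pverts G) P \<and> card P = 2 \<and> (\<forall>S \<in> P. delta_convex G S)"

text \<open>
  In the graph $T(G)$, \<open>Inl t\<close> is the vertex associated with a triangle \<open>t\<close>, and \<open>Inr v\<close> the one
  associated with a vertex \<open>v\<close> that lies in no triangle.
\<close>

definition T_graph :: "'a pair_pre_digraph \<Rightarrow> ('a set + 'a) pair_pre_digraph" where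
  "T_graph G =
     \<lparr> pverts = Inl ` triangles G \<union> Inr ` {v \<in> pverts G. \<forall>t \<in> triangles G. v \<notin> t},
       parcs = {(Inl s, Inl t) | s t.
                  s \<in> triangles G \<and> t \<in> triangles G \<and> s \<noteq> t \<and> s \<inter> t \<noteq> {}} \<rparr>"

lemma finite_triangles: "finite (pverts G) \<Longrightarrow> finite (triangles G)"
  by (rule finite_subset[of _ "Pow (pverts G)"]) (auto simp: triangles_def)

lemma pair_graph_T_graph:
  assumes "pair_graph G"
  shows "pair_graph (T_graph G)"
proof -
  interpret pair_graph G by fact
  have fin: "finite (triangles G)"
    using pair_finite_verts by (rule finite_triangles)
  have "parcs (T_graph G) \<subseteq> (Inl ` triangles G) \<times> (Inl ` triangles G)"
    by (auto simp: T_graph_def)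
  then have "finite (parcs (T_graph G))"
    by (rule finite_subset) (simp add: fin)
  then show ?thesis
    using fin pair_finite_verts
    by unfold_locales (auto simp: T_graph_def symmetric_def sym_def)
qed

end

(* T(G) is the intersection graph of a cover of V(G) by the triangles and the singletons of the
   vertices in no triangle. By pigeonhole, a 2-partition is Delta-convex iff no triangle meets both
   parts, i.e. iff no member of the cover does. Such partitions correspond to the partitions
   of V(T(G)) into two non-empty parts without edges in between. *)
theory Submission
  imports Defs
begin

text \<open>If \<open>v\<close> is not reachable from \<open>u\<close>, the set of vertices
  reachable from \<open>u\<close> is closed and misses \<open>v\<close>. Conversely, symmetry turns
  connectedness into strong connectedness, and no walk leaves a closed set. The second assumption
  excludes the null graph, which is not connected but has no such \<open>C\<close>.\<close>

lemma (in wf_digraph) not_connected_iff_closed: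
  assumes "symmetric G" and "verts G \<noteq> {}"
  shows "\<not> connected G \<longleftrightarrow>
    (\<exists>C. C \<noteq> {} \<and> C \<subset> verts G \<and> (\<forall>x\<in>C. \<forall>y. x \<rightarrow>\<^bsub>G\<^esub> y \<longrightarrow> y \<in> C))"
proof
  assume "\<not> connected G"
  then have "\<not> strongly_connected G"
    using reachable_mk_symmetricI by (auto simp: connected_def strongly_connected_def)
  then obtain u v where uv: "u \<in> verts G" "v \<in> verts G" "\<not> u \<rightarrow>\<^sup>* v"
    using assms(2) by (auto simp: strongly_connected_def)
  show "\<exists>C. C \<noteq> {} \<and> C \<subset> verts G \<and> (\<forall>x\<in>C. \<forall>y. x \<rightarrow>\<^bsub>G\<^esub> y \<longrightarrow> y \<in> C)"
  proof (intro exI conjI)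
    show "{w. u \<rightarrow>\<^sup>* w} \<noteq> {}" using uv by auto
    show "{w. u \<rightarrow>\<^sup>* w} \<subset> verts G" using uv by (auto dest: reachable_in_verts)
    show "\<forall>x\<in>{w. u \<rightarrow>\<^sup>* w}. \<forall>y. x \<rightarrow>\<^bsub>G\<^esub> y \<longrightarrow> y \<in> {w. u \<rightarrow>\<^sup>* w}"
      by (auto intro: reachable_adj_trans)
  qed
next
  assume "\<exists>C. C \<noteq> {} \<and> C \<subset> verts G \<and> (\<forall>x\<in>C. \<forall>y. x \<rightarrow>\<^bsub>G\<^esub> y \<longrightarrow> y \<in> C)"
  then obtain C u v where C: "u \<in> C" "v \<in> verts G - C" "C \<subset> verts G"
    and closed: "\<And>x y. x \<in> C \<Longrightarrow> x \<rightarrow>\<^bsub>G\<^esub> y \<Longrightarrow> y \<in> C"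
    by blast
  show "\<not> connected G"
  proof
    assume "connected G"
    then have "u \<rightarrow>\<^sup>* v"
      using symmetric_connected_imp_strongly_connected[OF assms(1)] C by blast
    then have "v \<in> C"
      by (induction rule: reachable_induct) (use C closed in auto)
    then show False using C by simp
  qed
qed

text \<open>The member of the cover of V(G) that a vertex of T(G) stands for.\<close>

definition support :: "'a set + 'a \<Rightarrow> 'a set" where
  "support = case_sum (\<lambda>t. t) (\<lambda>v. {v})"

lemma support_nonempty: "x \<in> pverts (T_graph G) \<Longrightarrow> support x \<noteq> {}"
  by (auto simp: T_graph_def support_def triangles_def)

lemma Union_support: "(\<Union>x\<in>pverts (T_graph G). support x) = pverts G"
  by (auto simp: T_graph_def support_def triangles_def)

text \<open>No case split on triangles is needed: a vertex in no triangle has a singleton support,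
  which meets no other support.\<close>

lemma T_graph_arc_iff:
  "(x, y) \<in> parcs (T_graph G) \<longleftrightarrow>
     x \<in> pverts (T_graph G) \<and> y \<in> pverts (T_graph G) \<and> x \<noteq> y \<and> support x \<inter> support y \<noteq> {}"
  by (cases x; cases y) (auto simp: T_graph_def support_def)

text \<open>The additional supports are singletons, which no set \<open>A\<close> can split.\<close>

lemma triangles_respect_iff_support:
  "(\<forall>t\<in>triangles G. t \<subseteq> A \<or> t \<inter> A = {}) \<longleftrightarrow>
     (\<forall>x\<in>pverts (T_graph G). support x \<subseteq> A \<or> support x \<inter> A = {})"
  by (auto simp: T_graph_def support_def ball_Un)

lemma triangle_respects_delta_convex:
  assumes "delta_convex G A" "delta_convex G (pverts G - A)" "t \<in> triangles G"
  shows "t \<subseteq> A \<or> t \<inter> A = {}"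
proof -
  obtain a b c where t: "t = {a, b, c}"
    using assms(3) by (auto simp: triangles_def card_3_iff)
  \<comment> \<open>\<open>delta_convex\<close> writes the outside vertex last, so each of the three
    vertices takes that place once.\<close>
  have "{a, b, c} \<in> triangles G" "{a, c, b} \<in> triangles G" "{b, c, a} \<in> triangles G"
    using assms(3) t by (simp_all add: insert_commute)
  moreover have "a \<in> pverts G" "b \<in> pverts G" "c \<in> pverts G"
    using assms(3) t by (auto simp: triangles_def)
  ultimately show ?thesis
    using assms(1,2) unfolding delta_convex_def t by blast
qed

lemma delta_convex_if_triangles_respect:
  assumes "A \<subseteq> pverts G" "\<And>t. t \<in> triangles G \<Longrightarrow> t \<subseteq> A \<or> t \<inter> A = {}"
  shows "delta_convex G A"
  using assms unfolding delta_convex_def by fastforce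

text \<open>One part determines the other as its complement, and a triangle avoids crossing
  \<open>A\<close> exactly when it avoids crossing the complement.\<close>

lemma delta_convex_2_partition_iff:
  "(\<exists>P. delta_convex_2_partition G P) \<longleftrightarrow>
     (\<exists>A. A \<noteq> {} \<and> A \<subset> pverts G \<and> (\<forall>t\<in>triangles G. t \<subseteq> A \<or> t \<inter> A = {}))"
proof
  assume "\<exists>P. delta_convex_2_partition G P"
  then obtain A B where AB: "partition_on (pverts G) {A, B}" "A \<noteq> B"
    "delta_convex G A" "delta_convex G B"
    unfolding delta_convex_2_partition_def card_2_iff by blast
  then have parts: "A \<noteq> {}" "B \<noteq> {}" "A \<inter> B = {}" "pverts G = A \<union> B"
    by (auto simp: partition_on_def disjoint_def)
  then have "B = pverts G - A" by blast
  then have "\<forall>t\<in>triangles G. t \<subseteq> A \<or> t \<inter> A = {}"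
    using AB(3,4) by (simp add: triangle_respects_delta_convex)
  moreover have "A \<subset> pverts G" using parts by blast
  ultimately show "\<exists>A. A \<noteq> {} \<and> A \<subset> pverts G \<and> (\<forall>t\<in>triangles G. t \<subseteq> A \<or> t \<inter> A = {})"
    using parts(1) by blast
next
  assume "\<exists>A. A \<noteq> {} \<and> A \<subset> pverts G \<and> (\<forall>t\<in>triangles G. t \<subseteq> A \<or> t \<inter> A = {})"
  then obtain A where A: "A \<noteq> {}" "A \<subset> pverts G"
    "\<And>t. t \<in> triangles G \<Longrightarrow> t \<subseteq> A \<or> t \<inter> A = {}"
    by blast
  let ?B = "pverts G - A"
  have "delta_convex G A"
    using A by (intro delta_convex_if_triangles_respect) auto
  moreover have "delta_convex G ?B"
  proof (rule delta_convex_if_triangles_respect)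
    show "t \<subseteq> ?B \<or> t \<inter> ?B = {}" if "t \<in> triangles G" for t
      using A(3)[OF that] that by (auto simp: triangles_def)
  qed simp
  moreover have "partition_on (pverts G) {A, ?B}"
    using A by (auto simp: partition_on_def disjoint_def)
  moreover have "card {A, ?B} = 2"
    using A by (subst card_2_iff) blast
  ultimately show "\<exists>P. delta_convex_2_partition G P"
    unfolding delta_convex_2_partition_def by blast
qed

text \<open>From \<open>A\<close>, take for \<open>C\<close> the vertices of T(G) with support
  inside \<open>A\<close>; from \<open>C\<close>, take for \<open>A\<close> the union of its
  supports.\<close>

lemma respecting_set_iff_closed:
  "(\<exists>A. A \<noteq> {} \<and> A \<subset> pverts G \<and> (\<forall>t\<in>triangles G. t \<subseteq> A \<or> t \<inter> A = {})) \<longleftrightarrow>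
     (\<exists>C. C \<noteq> {} \<and> C \<subset> pverts (T_graph G) \<and>
        (\<forall>x\<in>C. \<forall>y. (x, y) \<in> parcs (T_graph G) \<longrightarrow> y \<in> C))"
  (is "?L \<longleftrightarrow> ?R")
proof
  let ?V = "pverts (T_graph G)"
  assume ?L
  then obtain A where A: "A \<noteq> {}" "A \<subset> pverts G"
    and triangles: "\<forall>t\<in>triangles G. t \<subseteq> A \<or> t \<inter> A = {}"
    by (elim exE conjE)
  have respect: "support x \<subseteq> A \<or> support x \<inter> A = {}" if "x \<in> ?V" for x
    using triangles[unfolded triangles_respect_iff_support] that by (rule bspec)
  let ?C = "{x \<in> ?V. support x \<subseteq> A}"
  \<comment> \<open>A support through \<open>a\<close> puts a vertex into \<open>?C\<close>; a
    support through \<open>b\<close> keeps one out.\<close>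
  obtain a b where ab: "a \<in> A" "b \<in> pverts G" "b \<notin> A" using A by blast
  then have "a \<in> (\<Union>x\<in>?V. support x)" "b \<in> (\<Union>x\<in>?V. support x)"
    using A(2) unfolding Union_support by auto
  then obtain x y where x: "x \<in> ?V" "a \<in> support x" and y: "y \<in> ?V" "b \<in> support y"
    by blast
  have "x \<in> ?C" using x ab(1) respect[OF x(1)] by auto
  moreover have "y \<notin> ?C" using y(2) ab(3) by auto
  ultimately have "?C \<noteq> {}" "?C \<subset> ?V" using y(1) by auto
  moreover have "\<forall>u\<in>?C. \<forall>v. (u, v) \<in> parcs (T_graph G) \<longrightarrow> v \<in> ?C"
  proof (intro ballI allI impI)
    fix u v assume "u \<in> ?C" "(u, v) \<in> parcs (T_graph G)"
    \<comment> \<open>The support of \<open>v\<close> meets that of \<open>u\<close>, hence meets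
      \<open>A\<close>, hence lies inside \<open>A\<close>.\<close>
    then show "v \<in> ?C" using respect[of v] unfolding T_graph_arc_iff by auto
  qed
  ultimately show ?R by (intro exI[of _ ?C] conjI)
next
  let ?V = "pverts (T_graph G)"
  assume ?R
  then obtain C where C: "C \<noteq> {}" "C \<subset> ?V"
    and closed: "\<And>x y. x \<in> C \<Longrightarrow> (x, y) \<in> parcs (T_graph G) \<Longrightarrow> y \<in> C"
    by metis
  let ?A = "\<Union>x\<in>C. support x"
  \<comment> \<open>If the support of \<open>y\<close> met that of some \<open>x\<close> in
    \<open>C\<close>, then \<open>x\<close> and \<open>y\<close> would be adjacent and closedness
    would put \<open>y\<close> into \<open>C\<close>.\<close>
  have outside: "support y \<inter> ?A = {}" if "y \<in> ?V" "y \<notin> C" for y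
  proof -
    have "support y \<inter> support x = {}" if "x \<in> C" for x
      using closed[OF that, of y] C(2) that \<open>y \<in> ?V\<close> \<open>y \<notin> C\<close> unfolding T_graph_arc_iff by auto
    then show ?thesis by auto
  qed
  obtain x y where xy: "x \<in> C" "y \<in> ?V" "y \<notin> C" using C by blast
  have "x \<in> ?V" using xy(1) C(2) by auto
  from support_nonempty[OF this] have "?A \<noteq> {}"
    using xy(1) by blast
  moreover have "?A \<subset> pverts G"
  proof
    have "?A \<subseteq> (\<Union>x\<in>?V. support x)" using C(2) by (intro UN_mono) auto
    then show "?A \<subseteq> pverts G" by (simp only: Union_support)
    have "support y \<subseteq> (\<Union>x\<in>?V. support x)" using xy(2) by (rule UN_upper)
    then have "support y \<subseteq> pverts G" by (simp only: Union_support)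
    \<comment> \<open>The non-empty support of \<open>y\<close> lies in V(G) but is disjoint from
      \<open>?A\<close>.\<close>
    then show "?A \<noteq> pverts G"
      using outside[OF xy(2,3)] support_nonempty[OF xy(2)] by (metis inf.absorb1)
  qed
  moreover have "\<forall>t\<in>triangles G. t \<subseteq> ?A \<or> t \<inter> ?A = {}"
    unfolding triangles_respect_iff_support
  proof
    fix x assume "x \<in> ?V"
    then show "support x \<subseteq> ?A \<or> support x \<inter> ?A = {}"
      using outside[of x] by (cases "x \<in> C") (simp_all add: UN_upper)
  qed
  ultimately show ?L by (intro exI[of _ ?A] conjI)
qed

theorem theorem4:
  fixes G :: "'a pair_pre_digraph"
  assumes "pair_graph G"
    and "connected (with_proj G)"
    and "card (pverts G) \<ge> 3"
  shows "(\<exists>P. delta_convex_2_partition G P) \<longleftrightarrow> \<not> connected (with_proj (T_graph G))"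
proof -
  interpret T: pair_graph "T_graph G"
    using assms(1) by (rule pair_graph_T_graph)
  \<comment> \<open>The null graph counts as not connected, so T(G) must be shown to have a vertex:
    its supports cover the non-empty V(G).\<close>
  have "pverts (T_graph G) \<noteq> {}"
    using assms(3) Union_support[of G] by auto
  then show ?thesis
    unfolding delta_convex_2_partition_iff respecting_set_iff_closed
    using T.not_connected_iff_closed[OF T.pair_sym_arcs] by simp
qed

end
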